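(* Let $\mathcal{G}$ be an edge-weighted graph (as in the context). If $\overline{\mathcal{G}}$ is weakly connected, then $\overline{\mathcal{G}}$ is totally disconnected (as a topological space).
   Context: Graphs. $\mathcal{G}$ is a simple graph with countable vertex set $\mathcal{V}$ and countable edge set $\mathcal{E}$; each vertex has at least one and at most finitely many incident edges. Each edge $[u,v]\in\mathcal{E}$ has a length $R(u,v)=R(v,u)\in(0,\infty)$. Metric and completion. A finite path from $u$ to $v$ is a finite sequence of vertices $u=v_0,\dots,v_K=v$ with $[v_k,v_{k+1}]\in\mathcal{E}$. $d(u,v)=\inf_\gamma\sum_k R(v_k,v_{k+1})$, the infimum over finite paths $\gamma$ from $u$ to $v$ ($\infty$ if there is none). As a metric space $\mathcal{G}$ is identified with its vertex set, and $\overline{\mathcal{G}}$ is the metric completion. Paths in the completion. A path is a sequence $\{v_k\}$ of vertices with $[v_k,v_{k+1}]\in\mathcal{E}$, indexed by a finite set, by the positive integers (a ray), or by the integers (a double ray). It goes from $u\in\overline{\mathcal{G}}$ to $v\in\overline{\mathcal{G}}$ if it starts at $u$ (or, when infinite in that direction, converges to $u$) and ends at $v$ (or, when infinite in that direction, converges to $v$). Weakly connected. $\overline{\mathcal{G}}$ is weakly connected if for every pair of distinct points $u,v\in\overline{\mathcal{G}}$ there is a finite set $W$ of edges such that every path from $u$ to $v$ contains an edge from $W$. *)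

theory Defs
  imports "HOL-Analysis.Analysis"
begin

section \<open>Completion of an extended metric space\<close>

text \<open>
  The path distance of a disconnected graph takes the value \<open>\<infinity>\<close>, so the library's real-valued
  metric spaces do not apply. The completion is built in the usual way, from equivalence classes of
  Cauchy sequences, for a distance on a carrier set \<open>M\<close> with values in \<open>[0, \<infinity>]\<close>.
\<close>

definition ext_metric :: "'a set \<Rightarrow> ('a \<Rightarrow> 'a \<Rightarrow> ennreal) \<Rightarrow> bool" where
  "ext_metric M d \<longleftrightarrow>
     (\<forall>x\<in>M. \<forall>y\<in>M. d x y = 0 \<longleftrightarrow> x = y) \<and>
     (\<forall>x\<in>M. \<forall>y\<in>M. d x y = d y x) \<and>
     (\<forall>x\<in>M. \<forall>y\<in>M. \<forall>z\<in>M. d x z \<le> d x y + d y z)"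

definition ext_topology :: "'a set \<Rightarrow> ('a \<Rightarrow> 'a \<Rightarrow> ennreal) \<Rightarrow> 'a topology" where
  "ext_topology M d =
     topology (\<lambda>U. U \<subseteq> M \<and> (\<forall>x\<in>U. \<exists>e>0. {y \<in> M. d x y < e} \<subseteq> U))"

definition cauchy_seqs :: "'a set \<Rightarrow> ('a \<Rightarrow> 'a \<Rightarrow> ennreal) \<Rightarrow> (nat \<Rightarrow> 'a) set" where
  "cauchy_seqs M d =
     {x. range x \<subseteq> M \<and> (\<forall>e>0. \<exists>N. \<forall>m\<ge>N. \<forall>n\<ge>N. d (x m) (x n) < e)}"

definition cauchy_rel :: "'a set \<Rightarrow> ('a \<Rightarrow> 'a \<Rightarrow> ennreal) \<Rightarrow> ((nat \<Rightarrow> 'a) \<times> (nat \<Rightarrow> 'a)) set" where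
  "cauchy_rel M d =
     {(x, y). x \<in> cauchy_seqs M d \<and> y \<in> cauchy_seqs M d \<and> (\<lambda>n. d (x n) (y n)) \<longlonglongrightarrow> 0}"

definition ext_completion :: "'a set \<Rightarrow> ('a \<Rightarrow> 'a \<Rightarrow> ennreal) \<Rightarrow> (nat \<Rightarrow> 'a) set set" where
  "ext_completion M d = cauchy_seqs M d // cauchy_rel M d"

text \<open>The limit exists and is independent of the representatives; see \<open>completion_dist_tendsto\<close>.\<close>

definition completion_dist ::
    "('a \<Rightarrow> 'a \<Rightarrow> ennreal) \<Rightarrow> (nat \<Rightarrow> 'a) set \<Rightarrow> (nat \<Rightarrow> 'a) set \<Rightarrow> ennreal" where
  "completion_dist d X Y = (THE r. \<forall>x\<in>X. \<forall>y\<in>Y. (\<lambda>n. d (x n) (y n)) \<longlonglongrightarrow> r)"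

definition completion_embed :: "'a set \<Rightarrow> ('a \<Rightarrow> 'a \<Rightarrow> ennreal) \<Rightarrow> 'a \<Rightarrow> (nat \<Rightarrow> 'a) set" where
  "completion_embed M d a = cauchy_rel M d `` {\<lambda>_. a}"

definition completion_topology :: "'a set \<Rightarrow> ('a \<Rightarrow> 'a \<Rightarrow> ennreal) \<Rightarrow> (nat \<Rightarrow> 'a) set topology" where
  "completion_topology M d = ext_topology (ext_completion M d) (completion_dist d)"

definition totally_disconnected_space :: "'a topology \<Rightarrow> bool" where
  "totally_disconnected_space X \<longleftrightarrow> (\<forall>S. connectedin X S \<longrightarrow> (\<forall>x\<in>S. \<forall>y\<in>S. x = y))"

lemma istopology_ext: "istopology (\<lambda>U. U \<subseteq> M \<and> (\<forall>x\<in>U. \<exists>e>0. {y \<in> M. d x y < e} \<subseteq> U))"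
  for d :: "'a \<Rightarrow> 'a \<Rightarrow> ennreal"
  unfolding istopology_def
proof (intro conjI allI impI)
  fix S T
  assume S: "S \<subseteq> M \<and> (\<forall>x\<in>S. \<exists>e>0. {y \<in> M. d x y < e} \<subseteq> S)"
    and T: "T \<subseteq> M \<and> (\<forall>x\<in>T. \<exists>e>0. {y \<in> M. d x y < e} \<subseteq> T)"
  show "S \<inter> T \<subseteq> M" using S by blast
  show "\<forall>x\<in>S \<inter> T. \<exists>e>0. {y \<in> M. d x y < e} \<subseteq> S \<inter> T"
  proof
    fix x assume "x \<in> S \<inter> T"
    then have "\<exists>e>0. {y \<in> M. d x y < e} \<subseteq> S" "\<exists>e>0. {y \<in> M. d x y < e} \<subseteq> T"
      using S T by blast+
    then obtain e e' where "e > 0" "{y \<in> M. d x y < e} \<subseteq> S" "e' > 0" "{y \<in> M. d x y < e'} \<subseteq> T"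
      by blast
    then have "min e e' > 0 \<and> {y \<in> M. d x y < min e e'} \<subseteq> S \<inter> T"
      by (auto simp: subset_iff)
    then show "\<exists>e>0. {y \<in> M. d x y < e} \<subseteq> S \<inter> T" by blast
  qed
next
  fix K
  assume K: "\<forall>U\<in>K. U \<subseteq> M \<and> (\<forall>x\<in>U. \<exists>e>0. {y \<in> M. d x y < e} \<subseteq> U)"
  then show "\<Union>K \<subseteq> M" by blast
  show "\<forall>x\<in>\<Union>K. \<exists>e>0. {y \<in> M. d x y < e} \<subseteq> \<Union>K"
  proof
    fix x assume "x \<in> \<Union>K"
    then obtain U where "U \<in> K" "x \<in> U" by blast
    with K obtain e where "e > 0" "{y \<in> M. d x y < e} \<subseteq> U" by blast
    then show "\<exists>e>0. {y \<in> M. d x y < e} \<subseteq> \<Union>K" using \<open>U \<in> K\<close> by blast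
  qed
qed

lemma openin_ext_topology:
  "openin (ext_topology M d) U \<longleftrightarrow> U \<subseteq> M \<and> (\<forall>x\<in>U. \<exists>e>0. {y \<in> M. d x y < e} \<subseteq> U)"
  by (simp add: ext_topology_def topology_inverse'[OF istopology_ext])

lemma topspace_ext_topology [simp]: "topspace (ext_topology M d) = M"
proof
  show "topspace (ext_topology M d) \<subseteq> M"
    using openin_ext_topology openin_topspace by metis
  have "\<exists>e::ennreal. e > 0" using zero_less_one by blast
  then have "openin (ext_topology M d) M" by (auto simp: openin_ext_topology)
  then show "M \<subseteq> topspace (ext_topology M d)" by (rule openin_subset)
qed

lemma
  assumes "ext_metric M d"
  shows ext_metric_zero: "\<And>x y. x \<in> M \<Longrightarrow> y \<in> M \<Longrightarrow> d x y = 0 \<longleftrightarrow> x = y"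
    and ext_metric_sym: "\<And>x y. x \<in> M \<Longrightarrow> y \<in> M \<Longrightarrow> d x y = d y x"
    and ext_metric_tri: "\<And>x y z. x \<in> M \<Longrightarrow> y \<in> M \<Longrightarrow> z \<in> M \<Longrightarrow> d x z \<le> d x y + d y z"
  using assms unfolding ext_metric_def by blast+

lemma cauchy_dist_tendsto:
  assumes d: "ext_metric M d" and x: "x \<in> cauchy_seqs M d" and y: "y \<in> cauchy_seqs M d"
  shows "\<exists>r. (\<lambda>n. d (x n) (y n)) \<longlonglongrightarrow> r"
proof -
  let ?a = "\<lambda>n. d (x n) (y n)"
  have M: "x n \<in> M" "y n \<in> M" for n using x y by (auto simp: cauchy_seqs_def)
  have "limsup ?a \<le> liminf ?a"
  proof (rule ennreal_le_epsilon)
    fix e :: real assume "e > 0"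
    define h where "h = ennreal (e/2)"
    have h: "h > 0" "h + h = ennreal e"
      using \<open>e > 0\<close> by (simp_all add: h_def flip: ennreal_plus)
    obtain N1 where N1: "\<forall>m\<ge>N1. \<forall>n\<ge>N1. d (x m) (x n) < h"
      using x h(1) by (auto simp: cauchy_seqs_def)
    obtain N2 where N2: "\<forall>m\<ge>N2. \<forall>n\<ge>N2. d (y m) (y n) < h"
      using y h(1) by (auto simp: cauchy_seqs_def)
    have close: "?a n \<le> ?a m + ennreal e" if "m \<ge> max N1 N2" "n \<ge> max N1 N2" for m n
    proof -
      have "?a n \<le> d (x n) (x m) + d (x m) (y n)"
        by (rule ext_metric_tri[OF d M(1) M(1) M(2)])
      also have "d (x m) (y n) \<le> d (x m) (y m) + d (y m) (y n)"
        by (rule ext_metric_tri[OF d M(1) M(2) M(2)])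
      finally have "?a n \<le> d (x n) (x m) + (?a m + d (y m) (y n))"
        by (simp add: add_left_mono)
      also have "\<dots> \<le> h + (?a m + h)"
        using N1 N2 that by (intro add_mono order_refl less_imp_le) auto
      also have "\<dots> = ?a m + ennreal e" by (simp add: h(2)[symmetric] ac_simps)
      finally show ?thesis .
    qed
    have "limsup ?a \<le> ?a m + ennreal e" if "m \<ge> max N1 N2" for m
      using close[OF that] by (intro Limsup_bounded eventually_sequentiallyI)
    then have "limsup ?a - ennreal e \<le> ?a m" if "m \<ge> max N1 N2" for m
      using that by (simp add: ennreal_minus_le_iff add.commute del: max.bounded_iff)
    then have "limsup ?a - ennreal e \<le> liminf ?a"
      by (intro Liminf_bounded eventually_sequentiallyI)
    then show "limsup ?a \<le> liminf ?a + ennreal e"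
      by (simp add: ennreal_minus_le_iff add.commute)
  qed
  then have "liminf ?a = limsup ?a"
    by (simp add: Liminf_le_Limsup antisym)
  then have "?a \<longlonglongrightarrow> limsup ?a"
    by (intro Liminf_eq_Limsup) auto
  then show ?thesis ..
qed

lemma tendsto_dist_cong:
  assumes d: "ext_metric M d"
    and x: "(x, x') \<in> cauchy_rel M d" and y: "(y, y') \<in> cauchy_rel M d"
    and r: "(\<lambda>n. d (x n) (y n)) \<longlonglongrightarrow> r"
  shows "(\<lambda>n. d (x' n) (y' n)) \<longlonglongrightarrow> r"
proof -
  have M: "x n \<in> M" "x' n \<in> M" "y n \<in> M" "y' n \<in> M" for n
    using x y by (auto simp: cauchy_rel_def cauchy_seqs_def)
  have lx: "(\<lambda>n. d (x n) (x' n)) \<longlonglongrightarrow> 0" and ly: "(\<lambda>n. d (y n) (y' n)) \<longlonglongrightarrow> 0"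
    using x y by (auto simp: cauchy_rel_def)
  have bd: "d a b \<le> d a' a + (d a' b' + d b' b)"
    if "a \<in> M" "a' \<in> M" "b \<in> M" "b' \<in> M" for a b a' b'
  proof -
    have "d a b \<le> d a a' + d a' b" by (rule ext_metric_tri[OF d that(1,2,3)])
    also have "d a' b \<le> d a' b' + d b' b" by (rule ext_metric_tri[OF d that(2,4,3)])
    also have "d a a' = d a' a" by (rule ext_metric_sym[OF d that(1,2)])
    finally show ?thesis by (simp add: add_left_mono)
  qed
  obtain s where s: "(\<lambda>n. d (x' n) (y' n)) \<longlonglongrightarrow> s"
    using cauchy_dist_tendsto[OF d, of x' y'] x y by (auto simp: cauchy_rel_def)
  have "d (x' n) (y' n) \<le> d (x n) (x' n) + (d (x n) (y n) + d (y n) (y' n))" for n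
    by (rule bd[OF M(2,1,4,3)])
  then have "s \<le> 0 + (r + 0)"
    by (intro LIMSEQ_le[OF s tendsto_add[OF lx tendsto_add[OF r ly]]]) auto
  moreover have "d (x n) (y n) \<le> d (x n) (x' n) + (d (x' n) (y' n) + d (y n) (y' n))" for n
    using bd[OF M(1,2,3,4), of n n n n]
    by (simp only: ext_metric_sym[OF d M(2) M(1), of n n] ext_metric_sym[OF d M(4) M(3), of n n])
  then have "r \<le> 0 + (s + 0)"
    by (intro LIMSEQ_le[OF r tendsto_add[OF lx tendsto_add[OF s ly]]]) auto
  ultimately show ?thesis using s by simp
qed

lemma equiv_cauchy_rel:
  assumes d: "ext_metric M d"
  shows "equiv (cauchy_seqs M d) (cauchy_rel M d)"
proof (rule equivI)
  show "cauchy_rel M d \<subseteq> cauchy_seqs M d \<times> cauchy_seqs M d"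
    by (auto simp: cauchy_rel_def)
  show r: "refl_on (cauchy_seqs M d) (cauchy_rel M d)"
  proof (rule refl_onI)
    fix x assume x: "x \<in> cauchy_seqs M d"
    then have "d (x n) (x n) = 0" for n
      using ext_metric_zero[OF d, of "x n" "x n"] by (auto simp: cauchy_seqs_def)
    with x show "(x, x) \<in> cauchy_rel M d" by (simp add: cauchy_rel_def)
  qed
  show "sym (cauchy_rel M d)"
  proof (rule symI)
    fix x y assume xy: "(x, y) \<in> cauchy_rel M d"
    then have "d (x n) (y n) = d (y n) (x n)" for n
      by (intro ext_metric_sym[OF d]) (auto simp: cauchy_rel_def cauchy_seqs_def)
    with xy show "(y, x) \<in> cauchy_rel M d" by (simp add: cauchy_rel_def)
  qed
  show "trans (cauchy_rel M d)"
  proof (rule transI)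
    fix x y z assume xy: "(x, y) \<in> cauchy_rel M d" and yz: "(y, z) \<in> cauchy_rel M d"
    have "(x, x) \<in> cauchy_rel M d" using xy r by (auto simp: cauchy_rel_def refl_on_def)
    then have "(\<lambda>n. d (x n) (z n)) \<longlonglongrightarrow> 0"
      using tendsto_dist_cong[OF d _ yz, of x x 0] xy by (auto simp: cauchy_rel_def)
    with xy yz show "(x, z) \<in> cauchy_rel M d" by (auto simp: cauchy_rel_def)
  qed
qed

lemma completion_dist_tendsto:
  assumes d: "ext_metric M d" and X: "X \<in> ext_completion M d" and Y: "Y \<in> ext_completion M d"
    and x: "x \<in> X" and y: "y \<in> Y"
  shows "(\<lambda>n. d (x n) (y n)) \<longlonglongrightarrow> completion_dist d X Y"
proof -
  note eq = equiv_cauchy_rel[OF d]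
  have rel: "(a, b) \<in> cauchy_rel M d" if "a \<in> Z" "b \<in> Z" "Z \<in> ext_completion M d" for a b Z
    using quotient_eq_iff[OF eq, of Z Z a b] that by (auto simp: ext_completion_def)
  obtain r where r: "(\<lambda>n. d (x n) (y n)) \<longlonglongrightarrow> r"
    using cauchy_dist_tendsto[OF d, of x y] rel[OF x x X] rel[OF y y Y] by (auto simp: cauchy_rel_def)
  have "\<forall>x\<in>X. \<forall>y\<in>Y. (\<lambda>n. d (x n) (y n)) \<longlonglongrightarrow> r"
    using tendsto_dist_cong[OF d rel[OF x _ X] rel[OF y _ Y] r] by blast
  moreover from this have "completion_dist d X Y = r"
    unfolding completion_dist_def using x y by (intro the_equality) (assumption | meson LIMSEQ_unique)+
  ultimately show ?thesis using x y by blast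
qed

lemma completion_embed_isometry:
  assumes d: "ext_metric M d" and "a \<in> M" "b \<in> M"
  shows "completion_embed M d a \<in> ext_completion M d"
    and "completion_dist d (completion_embed M d a) (completion_embed M d b) = d a b"
proof -
  have c: "(\<lambda>_. z) \<in> cauchy_seqs M d" if "z \<in> M" for z
    using ext_metric_zero[OF d that that] that by (auto simp: cauchy_seqs_def)
  then have e: "completion_embed M d z \<in> ext_completion M d" if "z \<in> M" for z
    using that by (auto simp: completion_embed_def ext_completion_def intro: quotientI)
  then show "completion_embed M d a \<in> ext_completion M d" using assms by blast
  have m: "(\<lambda>_. z) \<in> completion_embed M d z" if "z \<in> M" for z
    using equiv_class_self[OF equiv_cauchy_rel[OF d] c[OF that]] by (simp add: completion_embed_def)
  have "(\<lambda>_. d a b) \<longlonglongrightarrow> completion_dist d (completion_embed M d a) (completion_embed M d b)"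
    using completion_dist_tendsto[OF d e e m m] assms by blast
  then show "completion_dist d (completion_embed M d a) (completion_embed M d b) = d a b"
    by (simp add: LIMSEQ_const_iff)
qed


section \<open>Edge-weighted graphs\<close>

text \<open>
  The edge \<open>[u, v]\<close> is the two-element set \<open>{u, v}\<close>. Values of \<open>R\<close> off the edges are irrelevant.
\<close>

locale edge_weighted_graph =
  fixes V :: "'v set" and E :: "'v set set" and R :: "'v \<Rightarrow> 'v \<Rightarrow> real"
  assumes countable_V: "countable V"
    and countable_E: "countable E"
    and simple: "e \<in> E \<Longrightarrow> \<exists>u\<in>V. \<exists>v\<in>V. u \<noteq> v \<and> e = {u, v}"
    and incident_nonempty: "v \<in> V \<Longrightarrow> {e \<in> E. v \<in> e} \<noteq> {}"
    and incident_finite: "v \<in> V \<Longrightarrow> finite {e \<in> E. v \<in> e}"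
    and R_sym: "{u, v} \<in> E \<Longrightarrow> R u v = R v u"
    and R_pos: "{u, v} \<in> E \<Longrightarrow> 0 < R u v"

definition finite_walk :: "'v set \<Rightarrow> 'v set set \<Rightarrow> 'v list \<Rightarrow> bool" where
  "finite_walk V E vs \<longleftrightarrow> vs \<noteq> [] \<and> set vs \<subseteq> V \<and> successively (\<lambda>u v. {u, v} \<in> E) vs"

definition walk_length :: "('v \<Rightarrow> 'v \<Rightarrow> real) \<Rightarrow> 'v list \<Rightarrow> real" where
  "walk_length R vs = (\<Sum>k<length vs - 1. R (vs ! k) (vs ! Suc k))"

definition graph_dist :: "'v set \<Rightarrow> 'v set set \<Rightarrow> ('v \<Rightarrow> 'v \<Rightarrow> real) \<Rightarrow> 'v \<Rightarrow> 'v \<Rightarrow> ennreal" where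
  "graph_dist V E R u v =
     (INF vs \<in> {vs. finite_walk V E vs \<and> hd vs = u \<and> last vs = v}. ennreal (walk_length R vs))"

lemma walk_length_singleton [simp]: "walk_length R [u] = 0"
  by (simp add: walk_length_def)

lemma walk_length_Cons [simp]:
  "walk_length R (u # w # vs) = R u w + walk_length R (w # vs)"
  by (simp add: walk_length_def sum.lessThan_Suc_shift del: sum.lessThan_Suc)

lemma walk_length_append:
  "walk_length R (us @ w # vs) = walk_length R (us @ [w]) + walk_length R (w # vs)"
proof (induction us)
  case (Cons u us)
  then show ?case by (cases us) auto
qed simp

context edge_weighted_graph
begin

lemma walk_length_nonneg: "successively (\<lambda>u v. {u, v} \<in> E) vs \<Longrightarrow> 0 \<le> walk_length R vs"
proof (induction vs rule: induct_list012)
  case 1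
  then show ?case by (simp add: walk_length_def)
next
  case (3 u w vs)
  then show ?case using R_pos[of u w] by (simp add: add_nonneg_nonneg)
qed simp

lemma walk_length_rev:
  "successively (\<lambda>u v. {u, v} \<in> E) vs \<Longrightarrow> walk_length R (rev vs) = walk_length R vs"
proof (induction vs rule: induct_list012)
  case (3 u w vs)
  have "walk_length R (rev (u # w # vs)) = walk_length R (rev (w # vs)) + R w u"
    using walk_length_append[of R "rev vs" w "[u]"] by simp
  with 3 show ?case using R_sym[of u w] by simp
qed simp_all

lemma finite_walk_rev:
  assumes "finite_walk V E vs"
  shows "finite_walk V E (rev vs)" "walk_length R (rev vs) = walk_length R vs"
proof -
  have "successively (\<lambda>u v. {v, u} \<in> E) vs = successively (\<lambda>u v. {u, v} \<in> E) vs"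
    by (rule successively_cong) (simp_all add: insert_commute)
  then show "finite_walk V E (rev vs)" "walk_length R (rev vs) = walk_length R vs"
    using assms walk_length_rev by (simp_all add: finite_walk_def)
qed

lemma graph_dist_le: "finite_walk V E vs \<Longrightarrow> graph_dist V E R (hd vs) (last vs) \<le> ennreal (walk_length R vs)"
  unfolding graph_dist_def by (rule INF_lower) simp

lemma graph_dist_sym_le: "graph_dist V E R u v \<le> graph_dist V E R v u"
proof -
  have "graph_dist V E R u v \<le> ennreal (walk_length R vs)"
    if "finite_walk V E vs" "hd vs = v" "last vs = u" for vs
    using graph_dist_le[OF finite_walk_rev(1)[OF that(1)]] finite_walk_rev(2)[OF that(1)] that
    by (simp add: hd_rev last_rev)
  then show ?thesis by (subst (2) graph_dist_def) (auto intro: INF_greatest)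
qed

lemma graph_dist_triangle: "graph_dist V E R u w \<le> graph_dist V E R u v + graph_dist V E R v w"
proof -
  let ?d = "graph_dist V E R"
  have *: "?d u w \<le> ennreal (walk_length R us) + ennreal (walk_length R vs)"
    if us: "finite_walk V E us" "hd us = u" "last us = v"
      and vs: "finite_walk V E vs" "hd vs = v" "last vs = w" for us vs
  proof -
    obtain us' where us': "us = us' @ [v]"
      using us by (metis append_butlast_last_id finite_walk_def)
    obtain vs' where vs': "vs = v # vs'"
      using vs by (metis finite_walk_def list.collapse)
    have "finite_walk V E (us' @ v # vs')"
      using us(1) vs(1) by (auto simp: us' vs' finite_walk_def successively_append_iff)
    moreover have "hd (us' @ v # vs') = u" "last (us' @ v # vs') = w"
      using us(2) vs(3) by (auto simp: us' vs' hd_append)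
    ultimately have "?d u w \<le> ennreal (walk_length R (us' @ v # vs'))"
      using graph_dist_le by metis
    also have "\<dots> = ennreal (walk_length R us) + ennreal (walk_length R vs)"
      using us(1) vs(1) walk_length_append[of R us' v vs'] walk_length_nonneg
      by (simp add: us' vs' finite_walk_def)
    finally show ?thesis .
  qed
  have bd: "?d u w \<le> ?d v w + ennreal (walk_length R us)"
    if us: "finite_walk V E us" "hd us = u" "last us = v" for us
  proof -
    have "?d u w - ennreal (walk_length R us) \<le> ?d v w"
      unfolding graph_dist_def[of V E R v w]
      using *[OF us] by (intro INF_greatest) (simp add: ennreal_minus_le_iff)
    then show ?thesis by (simp add: ennreal_minus_le_iff add.commute)
  qed
  show ?thesis
  proof (cases "?d v w = top")
    case False
    then have "?d u w - ?d v w \<le> ?d u v"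
      unfolding graph_dist_def[of V E R u v]
      using bd by (intro INF_greatest) (auto simp: ennreal_minus_le_iff)
    with False show ?thesis by (simp add: ennreal_minus_le_iff add.commute)
  qed simp
qed

lemma graph_dist_pos:
  assumes "u \<in> V" "u \<noteq> v"
  shows "0 < graph_dist V E R u v"
proof -
  let ?N = "{w. {u, w} \<in> E}"
  have "inj_on (\<lambda>w. {u, w}) ?N" by (auto simp: inj_on_def doubleton_eq_iff)
  then have fin: "finite ?N"
    by (rule inj_on_finite[OF _ _ incident_finite[OF assms(1)]]) auto
  define c where "c = Min (insert 1 (R u ` ?N))"
  have c: "0 < c" using fin R_pos by (simp add: c_def)
  have "ennreal c \<le> ennreal (walk_length R vs)"
    if walk: "finite_walk V E vs" "hd vs = u" "last vs = v" for vs
  proof -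
    obtain w ws where vs: "vs = u # w # ws"
      by (cases vs rule: remdups_adj.cases) (use walk assms(2) in \<open>auto simp: finite_walk_def\<close>)
    then have e: "{u, w} \<in> E" "successively (\<lambda>u v. {u, v} \<in> E) (w # ws)"
      using walk(1) by (auto simp: finite_walk_def)
    have "c \<le> R u w" unfolding c_def using fin e by (intro Min_le) auto
    then show ?thesis using walk_length_nonneg[OF e(2)] by (simp add: vs ennreal_leI)
  qed
  then have "ennreal c \<le> graph_dist V E R u v"
    unfolding graph_dist_def by (intro INF_greatest) auto
  with c show ?thesis by (metis ennreal_less_zero_iff less_le_trans)
qed

lemma ext_metric_graph_dist: "ext_metric V (graph_dist V E R)"
proof -
  have "graph_dist V E R u u = 0" if "u \<in> V" for u
    using graph_dist_le[of "[u]"] that by (simp add: finite_walk_def)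
  then show ?thesis
    unfolding ext_metric_def
    using graph_dist_pos graph_dist_sym_le graph_dist_triangle
    by (metis antisym less_irrefl)
qed

end

abbreviation graph_completion ::
    "'v set \<Rightarrow> 'v set set \<Rightarrow> ('v \<Rightarrow> 'v \<Rightarrow> real) \<Rightarrow> (nat \<Rightarrow> 'v) set set" where
  "graph_completion V E R \<equiv> ext_completion V (graph_dist V E R)"

abbreviation graph_completion_topology ::
    "'v set \<Rightarrow> 'v set set \<Rightarrow> ('v \<Rightarrow> 'v \<Rightarrow> real) \<Rightarrow> (nat \<Rightarrow> 'v) set topology" where
  "graph_completion_topology V E R \<equiv> completion_topology V (graph_dist V E R)"

abbreviation vertex_point ::
    "'v set \<Rightarrow> 'v set set \<Rightarrow> ('v \<Rightarrow> 'v \<Rightarrow> real) \<Rightarrow> 'v \<Rightarrow> (nat \<Rightarrow> 'v) set" where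
  "vertex_point V E R \<equiv> completion_embed V (graph_dist V E R)"


section \<open>Paths in the completion\<close>

datatype 'v gpath = Finite_Path "'v list" | Ray "nat \<Rightarrow> 'v" | Double_Ray "int \<Rightarrow> 'v"

fun is_gpath :: "'v set \<Rightarrow> 'v set set \<Rightarrow> 'v gpath \<Rightarrow> bool" where
  "is_gpath V E (Finite_Path vs) \<longleftrightarrow> finite_walk V E vs"
| "is_gpath V E (Ray p) \<longleftrightarrow> range p \<subseteq> V \<and> (\<forall>k. {p k, p (k + 1)} \<in> E)"
| "is_gpath V E (Double_Ray p) \<longleftrightarrow> range p \<subseteq> V \<and> (\<forall>k. {p k, p (k + 1)} \<in> E)"

fun gpath_edges :: "'v gpath \<Rightarrow> 'v set set" where
  "gpath_edges (Finite_Path vs) = {{vs ! k, vs ! Suc k} |k. Suc k < length vs}"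
| "gpath_edges (Ray p) = {{p k, p (k + 1)} |k. True}"
| "gpath_edges (Double_Ray p) = {{p k, p (k + 1)} |k. True}"

fun gpath_from ::
    "'v set \<Rightarrow> 'v set set \<Rightarrow> ('v \<Rightarrow> 'v \<Rightarrow> real) \<Rightarrow> 'v gpath \<Rightarrow> (nat \<Rightarrow> 'v) set \<Rightarrow> bool" where
  "gpath_from V E R (Finite_Path vs) X \<longleftrightarrow> vertex_point V E R (hd vs) = X"
| "gpath_from V E R (Ray p) X \<longleftrightarrow> vertex_point V E R (p 0) = X"
| "gpath_from V E R (Double_Ray p) X \<longleftrightarrow>
     limitin (graph_completion_topology V E R) (\<lambda>k. vertex_point V E R (p k)) X at_bot"

fun gpath_to ::
    "'v set \<Rightarrow> 'v set set \<Rightarrow> ('v \<Rightarrow> 'v \<Rightarrow> real) \<Rightarrow> 'v gpath \<Rightarrow> (nat \<Rightarrow> 'v) set \<Rightarrow> bool" where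
  "gpath_to V E R (Finite_Path vs) X \<longleftrightarrow> vertex_point V E R (last vs) = X"
| "gpath_to V E R (Ray p) X \<longleftrightarrow>
     limitin (graph_completion_topology V E R) (\<lambda>k. vertex_point V E R (p k)) X sequentially"
| "gpath_to V E R (Double_Ray p) X \<longleftrightarrow>
     limitin (graph_completion_topology V E R) (\<lambda>k. vertex_point V E R (p k)) X at_top"

text \<open>
  Both orders of each pair of points are considered, so a path that is infinite only towards its
  initial point is accounted for as a ray in the opposite direction.
\<close>

definition weakly_connected :: "'v set \<Rightarrow> 'v set set \<Rightarrow> ('v \<Rightarrow> 'v \<Rightarrow> real) \<Rightarrow> bool" where
  "weakly_connected V E R \<longleftrightarrow>
     (\<forall>X \<in> graph_completion V E R. \<forall>Y \<in> graph_completion V E R. X \<noteq> Y \<longrightarrow>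
        (\<exists>W. finite W \<and> W \<subseteq> E \<and>
           (\<forall>p. is_gpath V E p \<and> gpath_from V E R p X \<and> gpath_to V E R p Y \<longrightarrow>
                gpath_edges p \<inter> W \<noteq> {})))"

end

theory Submission
  imports Defs
begin

text \<open>
  Vertices are isolated points of the completion, so only two distinct boundary points \<open>X\<close>, \<open>Y\<close> need
  to be separated. Let \<open>W\<close> be a finite edge set met by every path from \<open>X\<close> to \<open>Y\<close>. A boundary point
  has positive distance to the finitely many endpoints of \<open>W\<close>, so short walks near it avoid \<open>W\<close>;
  hence every point of the completion has a neighbourhood whose vertices lie in a single component
  of the graph without \<open>W\<close>, and the closures of these components are clopen. If \<open>X\<close> and \<open>Y\<close> lay in
  the closure of the same component, short walks between successive approximating vertices could be
  concatenated to a double ray from \<open>X\<close> to \<open>Y\<close> avoiding \<open>W\<close>.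
\<close>

section \<open>The completion as an extended metric space\<close>

lemma ennreal_half_ex:
  fixes e :: ennreal
  assumes "0 < e"
  obtains h where "0 < h" "h + h \<le> e"
proof (cases e)
  case (real r)
  with assms have "0 < ennreal (r / 2)" "ennreal (r / 2) + ennreal (r / 2) \<le> e"
    by (auto simp flip: ennreal_plus)
  then show ?thesis using that by blast
next
  case top
  then show ?thesis using that[of 1] by simp
qed

lemma completion_representative:
  assumes d: "ext_metric M d" and X: "X \<in> ext_completion M d"
  obtains x where "x \<in> X" "x \<in> cauchy_seqs M d"
proof -
  obtain x where "x \<in> cauchy_seqs M d" "X = cauchy_rel M d `` {x}"
    using X by (auto simp: ext_completion_def elim: quotientE)
  then show ?thesis using that equiv_class_self[OF equiv_cauchy_rel[OF d]] by blast
qed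

text \<open>All distances are limits along representatives, so symmetry and the triangle inequality
  pass to the limit; distance zero is exactly equivalence of Cauchy sequences.\<close>

lemma ext_metric_completion:
  assumes d: "ext_metric M d"
  shows "ext_metric (ext_completion M d) (completion_dist d)"
  unfolding ext_metric_def
proof (intro conjI ballI)
  note eq = equiv_cauchy_rel[OF d] and lim = completion_dist_tendsto[OF d]
  fix X Y assume X: "X \<in> ext_completion M d" and Y: "Y \<in> ext_completion M d"
  obtain x where x: "x \<in> X" "x \<in> cauchy_seqs M d" using completion_representative[OF d X] .
  obtain y where y: "y \<in> Y" "y \<in> cauchy_seqs M d" using completion_representative[OF d Y] .
  have M: "x n \<in> M" "y n \<in> M" for n
    using x y by (auto simp: cauchy_seqs_def)
  show "completion_dist d X Y = 0 \<longleftrightarrow> X = Y"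
  proof
    assume "completion_dist d X Y = 0"
    then have "(x, y) \<in> cauchy_rel M d"
      using lim[OF X Y x(1) y(1)] x y by (simp add: cauchy_rel_def)
    then show "X = Y"
      using quotient_eq_iff[OF eq _ _ x(1) y(1)] X Y by (simp add: ext_completion_def)
  next
    assume "X = Y"
    then have "(\<lambda>n. d (x n) (x n)) \<longlonglongrightarrow> completion_dist d X Y"
      using lim[OF X Y x(1), of x] x by simp
    moreover have "d (x n) (x n) = 0" for n using ext_metric_zero[OF d] M by blast
    ultimately show "completion_dist d X Y = 0" by (simp add: LIMSEQ_const_iff)
  qed
  have "(\<lambda>n. d (x n) (y n)) \<longlonglongrightarrow> completion_dist d Y X"
    using lim[OF Y X y(1) x(1)] ext_metric_sym[OF d M(1) M(2)] by simp
  then show "completion_dist d X Y = completion_dist d Y X"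
    using LIMSEQ_unique[OF lim[OF X Y x(1) y(1)]] by blast
  fix Z assume Z: "Z \<in> ext_completion M d"
  obtain z where z: "z \<in> Z" "z \<in> cauchy_seqs M d" using completion_representative[OF d Z] .
  have "z n \<in> M" for n using z by (auto simp: cauchy_seqs_def)
  then have "d (x n) (z n) \<le> d (x n) (y n) + d (y n) (z n)" for n
    using ext_metric_tri[OF d] M by blast
  then show "completion_dist d X Z \<le> completion_dist d X Y + completion_dist d Y Z"
    by (intro LIMSEQ_le[OF lim[OF X Z x(1) z(1)]
          tendsto_add[OF lim[OF X Y x(1) y(1)] lim[OF Y Z y(1) z(1)]]]) auto
qed

text \<open>A late term of a Cauchy representative serves as \<open>v\<close>. Limits preserve only
  nonstrict bounds, so the Cauchy condition is applied with some \<open>h\<close> strictly below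
  \<open>e\<close>.\<close>

lemma completion_embed_dense:
  assumes d: "ext_metric M d" and X: "X \<in> ext_completion M d" and e: "0 < e"
  obtains v where "v \<in> M" "completion_dist d X (completion_embed M d v) < e"
proof -
  obtain x where x: "x \<in> X" "x \<in> cauchy_seqs M d" using completion_representative[OF d X] .
  obtain h where h: "0 < h" "h < e" using dense[OF e] by blast
  obtain N where N: "\<forall>m\<ge>N. \<forall>n\<ge>N. d (x m) (x n) < h"
    using x(2) h(1) by (auto simp: cauchy_seqs_def)
  have v: "x N \<in> M" using x(2) by (auto simp: cauchy_seqs_def)
  have "(\<lambda>_. x N) \<in> cauchy_seqs M d"
    using ext_metric_zero[OF d v v] v by (auto simp: cauchy_seqs_def)
  then have "(\<lambda>_. x N) \<in> completion_embed M d (x N)"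
    using equiv_class_self[OF equiv_cauchy_rel[OF d]] by (simp add: completion_embed_def)
  then have "(\<lambda>n. d (x n) (x N)) \<longlonglongrightarrow> completion_dist d X (completion_embed M d (x N))"
    using completion_dist_tendsto[OF d X completion_embed_isometry(1)[OF d v v] x(1)] by blast
  then have "completion_dist d X (completion_embed M d (x N)) \<le> h"
    by (rule LIMSEQ_le_const2) (use N in \<open>auto intro: less_imp_le exI[of _ N]\<close>)
  then show ?thesis using that v h(2) by (meson le_less_trans)
qed

lemma limitin_ext_topology:
  fixes d :: "'a \<Rightarrow> 'a \<Rightarrow> ennreal"
  assumes "X \<in> M" "\<And>k. f k \<in> M" "\<And>e. 0 < e \<Longrightarrow> \<forall>\<^sub>F k in F. d X (f k) < e"
  shows "limitin (ext_topology M d) f X F"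
  unfolding limitin_def
proof (intro conjI allI impI)
  fix U assume "openin (ext_topology M d) U \<and> X \<in> U"
  then obtain e where e: "0 < e" "{y \<in> M. d X y < e} \<subseteq> U"
    by (auto simp: openin_ext_topology)
  show "\<forall>\<^sub>F k in F. f k \<in> U"
    using assms(3)[OF e(1)] by eventually_elim (use e(2) assms(2) in auto)
qed (simp add: assms(1))

text \<open>The complement of the closure of \<open>S\<close> in the completion.\<close>

definition completion_exterior ::
    "'a set \<Rightarrow> ('a \<Rightarrow> 'a \<Rightarrow> ennreal) \<Rightarrow> 'a set \<Rightarrow> (nat \<Rightarrow> 'a) set set" where
  "completion_exterior M d S =
     {X \<in> ext_completion M d.
        \<exists>e>0. \<forall>v\<in>S. e \<le> completion_dist d X (completion_embed M d v)}"

lemma openin_completion_exterior: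
  assumes d: "ext_metric M d" and S: "S \<subseteq> M"
  shows "openin (completion_topology M d) (completion_exterior M d S)"
  unfolding completion_topology_def openin_ext_topology
proof (intro conjI ballI)
  let ?D = "completion_dist d" and ?i = "completion_embed M d"
  note D = ext_metric_completion[OF d]
  show "completion_exterior M d S \<subseteq> ext_completion M d"
    by (auto simp: completion_exterior_def)
  fix X assume "X \<in> completion_exterior M d S"
  then obtain e where X: "X \<in> ext_completion M d"
    and e: "0 < e" "\<And>v. v \<in> S \<Longrightarrow> e \<le> ?D X (?i v)"
    by (auto simp: completion_exterior_def)
  obtain h where h: "0 < h" "h + h \<le> e" using ennreal_half_ex[OF e(1)] .
  have "h \<le> ?D Y (?i v)" if Y: "Y \<in> ext_completion M d" "?D X Y < h" and v: "v \<in> S" for Y v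
  proof (rule ccontr)
    assume "\<not> h \<le> ?D Y (?i v)"
    then have "?D X Y + ?D Y (?i v) < h + h" using Y(2) by (intro add_strict_mono) auto
    moreover have "?D X (?i v) \<le> ?D X Y + ?D Y (?i v)"
      using v S by (intro ext_metric_tri[OF D X Y(1)] completion_embed_isometry(1)[OF d]) auto
    ultimately show False using e(2)[OF v] h(2) by auto
  qed
  then show "\<exists>e>0. {Y \<in> ext_completion M d. ?D X Y < e} \<subseteq> completion_exterior M d S"
    using h(1) by (intro exI[of _ h]) (auto simp: completion_exterior_def)
qed

text \<open>By density every point has elements of \<open>M\<close> arbitrarily close to it, and
  each of these lies in \<open>S\<close> or in \<open>M - S\<close>; no point can stay away from
  both.\<close>

lemma completion_exterior_disjoint:
  assumes d: "ext_metric M d"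
  shows "completion_exterior M d S \<inter> completion_exterior M d (M - S) = {}"
proof -
  have False if X: "X \<in> ext_completion M d"
    and e: "0 < e" "\<And>v. v \<in> S \<Longrightarrow> e \<le> completion_dist d X (completion_embed M d v)"
    and e': "0 < e'" "\<And>v. v \<in> M - S \<Longrightarrow> e' \<le> completion_dist d X (completion_embed M d v)"
    for X e e'
  proof -
    obtain v where "v \<in> M" "completion_dist d X (completion_embed M d v) < min e e'"
      using completion_embed_dense[OF d X, of "min e e'"] e(1) e'(1) by auto
    then show False using e(2)[of v] e'(2)[of v] by (cases "v \<in> S") auto
  qed
  then show ?thesis by (fastforce simp: completion_exterior_def)
qed

text \<open>The two exteriors are open and disjoint, so the covering hypothesis makes them
  complementary clopen sets, and a connected set cannot meet both.\<close>

lemma connectedin_completion_split: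
  assumes d: "ext_metric M d" and C: "C \<subseteq> M"
    and cover: "ext_completion M d \<subseteq> completion_exterior M d C \<union> completion_exterior M d (M - C)"
    and S: "connectedin (completion_topology M d) S" "X \<in> S" "Y \<in> S"
    and X: "X \<in> completion_exterior M d (M - C)"
  shows "Y \<in> completion_exterior M d (M - C)"
proof (rule ccontr)
  assume Y: "Y \<notin> completion_exterior M d (M - C)"
  have "S \<subseteq> ext_completion M d"
    using connectedin_subset_topspace[OF S(1)] by (simp add: completion_topology_def)
  then have "S \<subseteq> completion_exterior M d C \<union> completion_exterior M d (M - C)"
    "completion_exterior M d C \<inter> S \<noteq> {}"
    using cover S(3) Y by blast+
  moreover have "completion_exterior M d C \<inter> completion_exterior M d (M - C) \<inter> S = {}"
    using completion_exterior_disjoint[OF d] by blast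
  moreover have "completion_exterior M d (M - C) \<inter> S \<noteq> {}" using X S(2) by blast
  ultimately show False
    using S(1) openin_completion_exterior[OF d C] openin_completion_exterior[OF d Diff_subset, of C]
    unfolding connectedin by blast
qed

section \<open>Concatenating infinitely many walks\<close>

text \<open>Each walk is entered without its last vertex, which reappears as the head of the next
  one. Length at least 2 makes every contribution nonempty, so the result is infinite. The last
  conclusion, that late terms come from late walks, later yields convergence.\<close>

lemma concat_walks:
  fixes ws :: "nat \<Rightarrow> 'a list"
  assumes len: "\<And>n. 2 \<le> length (ws n)"
    and succ: "\<And>n. successively Q (ws n)"
    and link: "\<And>n. hd (ws (Suc n)) = last (ws n)"
  obtains p :: "nat \<Rightarrow> 'a" where "p 0 = hd (ws 0)" "\<And>k. Q (p k) (p (Suc k))"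
    "\<And>N. \<forall>\<^sub>F k in sequentially. \<exists>n\<ge>N. p k \<in> set (ws n)"
proof -
  define L where "L n = concat (map (butlast \<circ> ws) [0..<n])" for n
  have L_Suc: "L (Suc n) = L n @ butlast (ws n)" for n by (simp add: L_def)
  have ne: "ws n \<noteq> []" for n using len[of n] by auto
  have len_L: "n \<le> length (L n)" for n
  proof (induction n)
    case (Suc n)
    then show ?case using len[of n] by (simp add: L_Suc)
  qed simp
  have L_stable: "k < length (L m) \<and> L m ! k = L n ! k" if "n \<le> m" "k < length (L n)" for k m n
    using that by (induction m rule: dec_induct) (auto simp: L_Suc nth_append)
  \<comment> \<open>\<open>L (Suc k)\<close> has at least \<open>Suc k\<close> entries and later
    concatenations only extend it, so position \<open>k\<close> is already final there.\<close>
  define p where "p k = L (Suc k) ! k" for k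
  have p_eq: "p k = L n ! k" if "k < length (L n)" for k n
  proof -
    have "k < length (L (Suc k))" using len_L[of "Suc k"] by simp
    then show ?thesis
      using L_stable[of n "Suc k" k] L_stable[of "Suc k" n k] that
      by (cases "n \<le> Suc k") (auto simp: p_def)
  qed
  \<comment> \<open>Appending \<open>hd (ws n)\<close> restores the vertex dropped by the last
    \<open>butlast\<close>, so the induction also controls the edge at each junction.\<close>
  have walk: "successively Q (L n @ [hd (ws n)]) \<and> hd (L n @ [hd (ws n)]) = hd (ws 0)" for n
  proof (induction n)
    case 0
    then show ?case by (simp add: L_def)
  next
    case (Suc n)
    have eq: "L (Suc n) @ [hd (ws (Suc n))] = L n @ ws n"
      using append_butlast_last_id[OF ne[of n]] by (simp add: L_Suc link)
    have "successively Q (L n @ ws n)"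
      using Suc succ[of n] ne by (auto simp: successively_append_iff)
    moreover have "hd (L n @ ws n) = hd (ws 0)" using Suc by (auto simp: hd_append split: if_splits)
    ultimately show ?case by (simp add: eq)
  qed
  show ?thesis
  proof
    have "0 < length (L 1)" using len_L[of 1] by linarith
    then show "p 0 = hd (ws 0)"
      using walk[of 1] p_eq[of 0 1] by (auto simp: hd_append hd_conv_nth)
    show "Q (p k) (p (Suc k))" for k
    proof -
      have k: "Suc k < length (L (Suc (Suc k)))" using len_L[of "Suc (Suc k)"] by simp
      have "successively Q (L (Suc (Suc k)))"
        using walk[of "Suc (Suc k)"] by (auto simp: successively_append_iff)
      then have "Q (L (Suc (Suc k)) ! k) (L (Suc (Suc k)) ! Suc k)"
        using k by (auto simp: successively_conv_nth)
      then show ?thesis using p_eq[of k "Suc (Suc k)"] p_eq[OF k] k by simp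
    qed
    fix N
    have late: "k < length (L m) \<Longrightarrow> \<exists>n\<ge>N. L m ! k \<in> set (ws n)"
      if "N \<le> m" "length (L N) \<le> k" for k m
      using that
    proof (induction m rule: dec_induct)
      case (step m)
      show ?case
      proof (cases "k < length (L m)")
        case False
        then have "L (Suc m) ! k \<in> set (butlast (ws m))"
          using step.prems(1) by (auto simp: L_Suc nth_append)
        then show ?thesis using step.hyps by (auto dest: in_set_butlastD)
      qed (use step in \<open>auto simp: L_Suc nth_append\<close>)
    qed simp
    show "\<forall>\<^sub>F k in sequentially. \<exists>n\<ge>N. p k \<in> set (ws n)"
    proof (rule eventually_sequentiallyI)
      fix k assume k: "length (L N) \<le> k"
      then have "N \<le> Suc k" using len_L[of N] by simp
      then show "\<exists>n\<ge>N. p k \<in> set (ws n)"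
        using late[of "Suc k" k] k len_L[of "Suc k"] by (simp add: p_def)
    qed
  qed
qed

section \<open>Walks avoiding finitely many edges\<close>

lemma successively_if_rtrancl:
  assumes "(u, v) \<in> r\<^sup>*"
  obtains vs where "vs \<noteq> []" "hd vs = u" "last vs = v" "successively (\<lambda>x y. (x, y) \<in> r) vs"
  using assms
proof (induction arbitrary: thesis rule: converse_rtrancl_induct)
  case base
  then show ?case by (metis last.simps list.distinct(1) list.sel(1) successively.simps(2))
next
  case (step u w)
  obtain vs where "vs \<noteq> []" "hd vs = w" "last vs = v" "successively (\<lambda>x y. (x, y) \<in> r) vs"
    using step.IH .
  then show ?case using step.hyps(1) by (intro step.prems[of "u # vs"]) (auto simp: successively_Cons)
qed

lemma rtrancl_if_successively:
  assumes "successively (\<lambda>x y. (x, y) \<in> r) vs" "vs \<noteq> []"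
  shows "(hd vs, last vs) \<in> r\<^sup>*"
  using assms
proof (induction vs rule: induct_list012)
  case (3 u w vs)
  then have "(u, w) \<in> r" "(w, last (w # vs)) \<in> r\<^sup>*" by simp_all
  then show ?case by (simp add: converse_rtrancl_into_rtrancl)
qed simp_all

context edge_weighted_graph
begin

abbreviation "gd \<equiv> graph_dist V E R"
abbreviation "cd \<equiv> completion_dist gd"
abbreviation "pt \<equiv> vertex_point V E R"
abbreviation "CG \<equiv> graph_completion V E R"

lemmas gd = ext_metric_graph_dist
lemmas cd = ext_metric_completion[OF gd]
lemmas cd_zero = ext_metric_zero[OF cd]
lemmas cd_sym = ext_metric_sym[OF cd]
lemmas cd_tri = ext_metric_tri[OF cd]

lemma pt_in: "v \<in> V \<Longrightarrow> pt v \<in> CG"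
  using completion_embed_isometry(1)[OF gd] by blast

lemma cd_pt: "u \<in> V \<Longrightarrow> v \<in> V \<Longrightarrow> cd (pt u) (pt v) = gd u v"
  using completion_embed_isometry(2)[OF gd] by blast

lemma edge_vertices: "{u, v} \<in> E \<Longrightarrow> u \<in> V \<and> v \<in> V"
  using simple[of "{u, v}"] by (auto simp: doubleton_eq_iff)

text \<open>A walk leaving \<open>u\<close> must first cross one of the finitely many edges at
  \<open>u\<close>. The least of their lengths, capped at 1, is a bound independent of
  \<open>v\<close>.\<close>

lemma vertex_isolated:
  assumes "u \<in> V"
  obtains c where "0 < c" "\<And>v. v \<noteq> u \<Longrightarrow> c \<le> gd u v"
proof -
  let ?N = "{w. {u, w} \<in> E}"
  have "inj_on (\<lambda>w. {u, w}) ?N" by (auto simp: inj_on_def doubleton_eq_iff)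
  then have fin: "finite ?N"
    by (rule inj_on_finite[OF _ _ incident_finite[OF assms(1)]]) auto
  define c where "c = Min (insert 1 (R u ` ?N))"
  have c: "0 < c" using fin R_pos by (simp add: c_def)
  have "ennreal c \<le> ennreal (walk_length R vs)"
    if walk: "finite_walk V E vs" "hd vs = u" "last vs = v" and "v \<noteq> u" for v vs
  proof -
    obtain w ws where vs: "vs = u # w # ws"
      by (cases vs rule: remdups_adj.cases) (use walk \<open>v \<noteq> u\<close> in \<open>auto simp: finite_walk_def\<close>)
    then have e: "{u, w} \<in> E" "successively (\<lambda>u v. {u, v} \<in> E) (w # ws)"
      using walk(1) by (auto simp: finite_walk_def)
    have "c \<le> R u w" unfolding c_def using fin e by (intro Min_le) auto
    then show ?thesis using walk_length_nonneg[OF e(2)] by (simp add: vs ennreal_leI)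
  qed
  then have "ennreal c \<le> gd u v" if "v \<noteq> u" for v
    unfolding graph_dist_def using that by (intro INF_greatest) auto
  then show ?thesis using that[of "ennreal c"] c by auto
qed

section \<open>Short walks and the edges they can use\<close>

lemma graph_dist_walk_member:
  assumes "finite_walk V E vs" "w \<in> set vs"
  shows "gd (hd vs) w \<le> ennreal (walk_length R vs)"
proof -
  obtain us zs where vs: "vs = us @ w # zs" using split_list[OF assms(2)] by blast
  have walk: "finite_walk V E (us @ [w])" and s: "successively (\<lambda>u v. {u, v} \<in> E) (w # zs)"
    using assms(1) by (auto simp: vs finite_walk_def successively_append_iff)
  have "hd (us @ [w]) = hd vs" by (simp add: vs hd_append)
  then have "gd (hd vs) w \<le> ennreal (walk_length R (us @ [w]))"
    using graph_dist_le[OF walk] by simp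
  also have "\<dots> \<le> ennreal (walk_length R vs)"
    using walk_length_nonneg[OF s] walk_length_append[of R us w zs] by (simp add: vs ennreal_leI)
  finally show ?thesis .
qed

text \<open>A walk of length below \<delta> stays in the \<delta>-ball around \<open>u\<close>,
  where by \<open>far\<close> no edge of \<open>W\<close> has an endpoint.\<close>

lemma walk_avoiding:
  assumes far: "\<And>w e. e \<in> W \<Longrightarrow> w \<in> e \<Longrightarrow> w \<in> V \<Longrightarrow> \<delta> \<le> gd u w" and "gd u v < \<delta>"
  obtains vs where "vs \<noteq> []" "hd vs = u" "last vs = v" "set vs \<subseteq> V"
    "successively (\<lambda>x y. {x, y} \<in> E - W) vs" "\<And>w. w \<in> set vs \<Longrightarrow> gd u w < \<delta>"
proof -
  obtain vs where vs: "finite_walk V E vs" "hd vs = u" "last vs = v" "ennreal (walk_length R vs) < \<delta>"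
    using assms(2) unfolding graph_dist_def INF_less_iff by auto
  have near: "gd u w < \<delta>" if "w \<in> set vs" for w
    using graph_dist_walk_member[OF vs(1) that] vs(2,4) by auto
  have "successively (\<lambda>x y. {x, y} \<in> E - W) vs"
  proof (rule successively_mono)
    show "successively (\<lambda>x y. {x, y} \<in> E) vs" using vs(1) by (simp add: finite_walk_def)
    fix x y assume "x \<in> set vs" "y \<in> set vs" "{x, y} \<in> E"
    then show "{x, y} \<in> E - W"
      using near[of x] far[of "{x, y}" x] vs(1) by (auto simp: finite_walk_def)
  qed
  then show ?thesis using that vs near by (auto simp: finite_walk_def)
qed

lemma edges_far_from_boundary:
  assumes X: "X \<in> CG" "X \<notin> pt ` V" and W: "finite W" "W \<subseteq> E"
  obtains \<delta> where "0 < \<delta>" "\<And>w e. e \<in> W \<Longrightarrow> w \<in> e \<Longrightarrow> \<delta> \<le> cd X (pt w)"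
proof -
  have "finite e" if "e \<in> W" for e
    using that W(2) simple[of e] by auto
  then have fin: "finite (\<Union>W)" using W(1) by blast
  have V: "\<Union>W \<subseteq> V" using W(2) simple by blast
  have pos: "0 < cd X (pt w)" if "w \<in> \<Union>W" for w
  proof -
    have "w \<in> V" using that V by blast
    then show ?thesis using cd_zero[OF X(1) pt_in] X(2) by (auto simp: zero_less_iff_neq_zero)
  qed
  \<comment> \<open>The inserted 1 keeps the minimum defined when \<open>W\<close> is empty.\<close>
  define \<delta> where "\<delta> = Min (insert 1 ((\<lambda>w. cd X (pt w)) ` \<Union>W))"
  have "0 < \<delta>" using fin pos by (simp add: \<delta>_def)
  moreover have "\<delta> \<le> cd X (pt w)" if "e \<in> W" "w \<in> e" for w e
    unfolding \<delta>_def using fin that by (intro Min_le) auto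
  ultimately show ?thesis using that by blast
qed

text \<open>Two halvings suffice: vertices within \<eta> of \<open>X\<close> are less than
  \<open>h\<close> apart, and a walk of length below \<open>h\<close> starting there stays within
  \<open>h + h\<close> of \<open>X\<close>. This is below the distance from \<open>X\<close> to
  \<open>W\<close> and below \<epsilon>; the latter bound is what makes the rays built later
  converge.\<close>

lemma local_walks_boundary:
  assumes X: "X \<in> CG" "X \<notin> pt ` V" and W: "finite W" "W \<subseteq> E" and e: "0 < \<epsilon>"
  obtains \<eta> where "0 < \<eta>"
    "\<And>u v. u \<in> V \<Longrightarrow> v \<in> V \<Longrightarrow> cd X (pt u) < \<eta> \<Longrightarrow> cd X (pt v) < \<eta> \<Longrightarrow>
       \<exists>vs. vs \<noteq> [] \<and> hd vs = u \<and> last vs = v \<and> successively (\<lambda>x y. {x, y} \<in> E - W) vs \<and>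
         (\<forall>w\<in>set vs. w \<in> V \<and> cd X (pt w) < \<epsilon>)"
proof -
  obtain \<delta> where \<delta>: "0 < \<delta>" "\<And>w e. e \<in> W \<Longrightarrow> w \<in> e \<Longrightarrow> \<delta> \<le> cd X (pt w)"
    using edges_far_from_boundary[OF X W] by blast
  obtain h where h: "0 < h" "h + h \<le> min \<epsilon> \<delta>"
    using ennreal_half_ex[of "min \<epsilon> \<delta>"] \<delta>(1) e by auto
  obtain \<eta> where \<eta>: "0 < \<eta>" "\<eta> + \<eta> \<le> h" using ennreal_half_ex[OF h(1)] .
  have "\<eta> \<le> h" using \<eta>(2) by (meson le_iff_add order_trans)
  show ?thesis
  proof
    show "0 < \<eta>" by fact
    fix u v assume u: "u \<in> V" and v: "v \<in> V" and uX: "cd X (pt u) < \<eta>" and vX: "cd X (pt v) < \<eta>"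
    have close: "cd X (pt w) < min \<epsilon> \<delta>" if "w \<in> V" "gd u w < h" for w
    proof -
      have "cd X (pt w) \<le> cd X (pt u) + cd (pt u) (pt w)"
        by (rule cd_tri[OF X(1) pt_in[OF u] pt_in[OF that(1)]])
      also have "\<dots> < h + h"
        using uX \<open>\<eta> \<le> h\<close> that(2) by (intro add_strict_mono) (auto simp: cd_pt[OF u that(1)])
      finally show ?thesis using h(2) by (rule less_le_trans)
    qed
    have "gd u v = cd (pt u) (pt v)" using cd_pt u v by simp
    also have "\<dots> \<le> cd (pt u) X + cd X (pt v)"
      by (rule cd_tri[OF pt_in[OF u] X(1) pt_in[OF v]])
    also have "\<dots> < \<eta> + \<eta>"
      using uX vX cd_sym[OF X(1) pt_in[OF u]] by (intro add_strict_mono) auto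
    finally have uv: "gd u v < h" using \<eta>(2) by (rule less_le_trans)
    have far: "h \<le> gd u w" if "e \<in> W" "w \<in> e" "w \<in> V" for w e
      using close[OF that(3)] \<delta>(2)[OF that(1,2)] by (meson leD leI min_less_iff_conj)
    show "\<exists>vs. vs \<noteq> [] \<and> hd vs = u \<and> last vs = v \<and> successively (\<lambda>x y. {x, y} \<in> E - W) vs \<and>
         (\<forall>w\<in>set vs. w \<in> V \<and> cd X (pt w) < \<epsilon>)"
    proof (rule walk_avoiding[OF far uv])
      fix vs
      assume vs: "vs \<noteq> []" "hd vs = u" "last vs = v" "set vs \<subseteq> V"
        "successively (\<lambda>x y. {x, y} \<in> E - W) vs" "\<And>w. w \<in> set vs \<Longrightarrow> gd u w < h"
      have "w \<in> V \<and> cd X (pt w) < \<epsilon>" if "w \<in> set vs" for w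
        using close[of w] vs(4) vs(6)[OF that] that by auto
      then show ?thesis using vs(1-3,5) by blast
    qed
  qed
qed

section \<open>Components of the graph after deleting finitely many edges\<close>

definition edges_without :: "'v set set \<Rightarrow> ('v \<times> 'v) set" where
  "edges_without W = {(u, v). {u, v} \<in> E - W}"

text \<open>A small ball around a vertex contains no other vertex. Around a boundary point the short
  walks avoiding \<open>W\<close> give the connection; their radius is irrelevant here, hence the
  choice 1.\<close>

lemma local_connectivity:
  assumes Z: "Z \<in> CG" and W: "finite W" "W \<subseteq> E"
  obtains \<delta> where "0 < \<delta>"
    "\<And>u v. u \<in> V \<Longrightarrow> v \<in> V \<Longrightarrow> cd Z (pt u) < \<delta> \<Longrightarrow> cd Z (pt v) < \<delta> \<Longrightarrow>
       (u, v) \<in> (edges_without W)\<^sup>*"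
proof (cases "Z \<in> pt ` V")
  case True
  then obtain z where z: "z \<in> V" "Z = pt z" by blast
  obtain c where "0 < c" "\<And>v. v \<noteq> z \<Longrightarrow> c \<le> gd z v" using vertex_isolated[OF z(1)] by blast
  then show ?thesis using that[of c] cd_pt[OF z(1)] z(2) by (metis leD rtrancl.rtrancl_refl)
next
  case False
  obtain \<eta> where \<eta>: "0 < \<eta>" "\<And>u v. u \<in> V \<Longrightarrow> v \<in> V \<Longrightarrow> cd Z (pt u) < \<eta> \<Longrightarrow> cd Z (pt v) < \<eta> \<Longrightarrow>
       \<exists>vs. vs \<noteq> [] \<and> hd vs = u \<and> last vs = v \<and> successively (\<lambda>x y. {x, y} \<in> E - W) vs \<and>
         (\<forall>w\<in>set vs. w \<in> V \<and> cd Z (pt w) < 1)"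
    using local_walks_boundary[OF Z False W, of 1] by auto
  show ?thesis
  proof (rule that[OF \<eta>(1)])
    fix u v assume "u \<in> V" "v \<in> V" "cd Z (pt u) < \<eta>" "cd Z (pt v) < \<eta>"
    then obtain vs where "vs \<noteq> []" "hd vs = u" "last vs = v"
      "successively (\<lambda>x y. {x, y} \<in> E - W) vs"
      using \<eta>(2) by blast
    then show "(u, v) \<in> (edges_without W)\<^sup>*"
      using rtrancl_if_successively[of "edges_without W" vs] by (simp add: edges_without_def)
  qed
qed

section \<open>Rays and double rays converging to boundary points\<close>

text \<open>An initial walk brings \<open>u\<close> close to \<open>X\<close>; afterwards ever
  shorter local walks link vertices approaching \<open>X\<close>. All of them avoid
  \<open>W\<close>, and their concatenation is the ray.\<close>

lemma ray_to_boundary: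
  assumes X: "X \<in> CG" "X \<notin> pt ` V" and W: "finite W" "W \<subseteq> E" and u: "u \<in> V"
    and acc: "\<And>e. 0 < e \<Longrightarrow> \<exists>v\<in>V. (u, v) \<in> (edges_without W)\<^sup>* \<and> cd X (pt v) < e"
  obtains q :: "nat \<Rightarrow> 'v" where "q 0 = u" "\<And>k. {q k, q (Suc k)} \<in> E - W"
    "\<And>e. 0 < e \<Longrightarrow> \<forall>\<^sub>F k in sequentially. cd X (pt (q k)) < e"
proof -
  let ?succ = "successively (\<lambda>x y. {x, y} \<in> E - W)"
  let ?\<epsilon> = "\<lambda>n. ennreal (inverse (real (Suc n)))"
  have \<epsilon>_pos: "0 < ?\<epsilon> n" for n by simp
  have "\<forall>n. \<exists>\<eta>>0. \<forall>u\<in>V. \<forall>v\<in>V. cd X (pt u) < \<eta> \<longrightarrow> cd X (pt v) < \<eta> \<longrightarrow>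
       (\<exists>vs. vs \<noteq> [] \<and> hd vs = u \<and> last vs = v \<and> ?succ vs \<and>
         (\<forall>w\<in>set vs. w \<in> V \<and> cd X (pt w) < ?\<epsilon> n))"
    by (metis local_walks_boundary[OF X W \<epsilon>_pos])
  then obtain \<eta> where \<eta>: "\<And>n. 0 < \<eta> n" "\<And>n u v. u \<in> V \<Longrightarrow> v \<in> V \<Longrightarrow> cd X (pt u) < \<eta> n \<Longrightarrow>
       cd X (pt v) < \<eta> n \<Longrightarrow> \<exists>vs. vs \<noteq> [] \<and> hd vs = u \<and> last vs = v \<and> ?succ vs \<and>
         (\<forall>w\<in>set vs. w \<in> V \<and> cd X (pt w) < ?\<epsilon> n)"
    by metis
  have pos: "0 < cd X (pt v)" if "v \<in> V" for v
    using cd_zero[OF X(1) pt_in[OF that]] X(2) that by (auto simp: zero_less_iff_neq_zero)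
  have two: "2 \<le> length vs" if "vs \<noteq> []" "hd vs \<noteq> last vs" for vs :: "'v list"
    using that by (cases vs rule: remdups_adj.cases) auto
  \<comment> \<open>Walk \<open>n\<close> ends within \<open>\<eta> n\<close> of \<open>X\<close>,
    which is what choosing walk \<open>Suc n\<close> inside the ball of radius
    \<open>?\<epsilon> n\<close> requires. Walk 0 may wander far from \<open>X\<close>, so the
    radius condition starts only at index 1.\<close>
  let ?P = "\<lambda>n vs. 2 \<le> length vs \<and> ?succ vs \<and> (n = 0 \<longrightarrow> hd vs = u) \<and>
    (\<forall>m. n = Suc m \<longrightarrow> (\<forall>w\<in>set vs. cd X (pt w) < ?\<epsilon> m)) \<and>
    last vs \<in> V \<and> cd X (pt (last vs)) < \<eta> n"
  have "\<exists>ws. \<forall>n. ?P n (ws n) \<and> hd (ws (Suc n)) = last (ws n)"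
  proof (rule dependent_nat_choice)
    \<comment> \<open>The bound \<open>cd X (pt u)\<close> forces \<open>v\<close> to differ from
      \<open>u\<close>, so the initial walk has an edge.\<close>
    obtain v where v: "v \<in> V" "(u, v) \<in> (edges_without W)\<^sup>*" "cd X (pt v) < min (\<eta> 0) (cd X (pt u))"
      using acc[of "min (\<eta> 0) (cd X (pt u))"] \<eta>(1)[of 0] pos[OF u] by auto
    obtain vs where vs: "vs \<noteq> []" "hd vs = u" "last vs = v"
      "successively (\<lambda>x y. (x, y) \<in> edges_without W) vs"
      using successively_if_rtrancl[OF v(2)] .
    have "u \<noteq> v" using v(3) by auto
    then show "\<exists>vs. ?P 0 vs"
      using vs v two[OF vs(1)] by (intro exI[of _ vs]) (auto simp: edges_without_def)
  next
    fix vs n assume vs: "?P n vs"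
    \<comment> \<open>Moving strictly closer to \<open>X\<close> makes the new endpoint differ from the old one, so no walk is trivial.\<close>
    let ?e = "min (min (\<eta> n) (\<eta> (Suc n))) (cd X (pt (last vs)))"
    have "0 < ?e" using \<eta>(1) pos vs by simp
    then obtain v where v: "v \<in> V" "cd X (pt v) < ?e"
      using completion_embed_dense[OF gd X(1)] by blast
    obtain vs' where vs': "vs' \<noteq> []" "hd vs' = last vs" "last vs' = v" "?succ vs'"
      "\<forall>w\<in>set vs'. w \<in> V \<and> cd X (pt w) < ?\<epsilon> n"
      using \<eta>(2)[of "last vs" v n] vs v by auto
    have "last vs \<noteq> v" using v(2) by auto
    then show "\<exists>vs'. ?P (Suc n) vs' \<and> hd vs' = last vs"
      using vs' v two[OF vs'(1)] by (intro exI[of _ vs']) auto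
  qed
  then obtain ws where ws: "\<And>n. ?P n (ws n)" "\<And>n. hd (ws (Suc n)) = last (ws n)" by blast
  have ws': "\<And>n. 2 \<le> length (ws n)" "\<And>n. ?succ (ws n)" using ws(1) by blast+
  obtain q where q: "q 0 = hd (ws 0)" "\<And>k. {q k, q (Suc k)} \<in> E - W"
    "\<And>N. \<forall>\<^sub>F k in sequentially. \<exists>n\<ge>N. q k \<in> set (ws n)"
    by (rule concat_walks[of ws, OF ws' ws(2)]) (rule that; assumption)
  show ?thesis
  proof (rule that[of q])
    show "q 0 = u" using q(1) ws(1)[of 0] by simp
    show "{q k, q (Suc k)} \<in> E - W" for k by (rule q(2))
    \<comment> \<open>Terms lying on walks with index at least \<open>Suc N\<close> are within
      \<open>?\<epsilon> N\<close> of \<open>X\<close>; the real number \<open>r\<close> replaces a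
      possibly infinite \<open>e\<close>.\<close>
    fix e :: ennreal assume "0 < e"
    then obtain r where r: "0 < r" "ennreal r \<le> e"
      by (cases e) (auto intro: zero_less_one)
    obtain N where N: "inverse (real (Suc N)) < r" using reals_Archimedean[OF r(1)] by blast
    show "\<forall>\<^sub>F k in sequentially. cd X (pt (q k)) < e"
      using q(3)[of "Suc N"]
    proof eventually_elim
      case (elim k)
      then obtain m where m: "N \<le> m" "q k \<in> set (ws (Suc m))" by (metis Suc_le_D Suc_le_mono)
      then have "cd X (pt (q k)) < ?\<epsilon> m" using ws(1)[of "Suc m"] by blast
      also have "?\<epsilon> m \<le> ?\<epsilon> N" using m(1) by (intro ennreal_leI) (simp add: field_simps)
      also have "?\<epsilon> N \<le> e" using N r(2) by (meson ennreal_leI less_imp_le order_trans)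
      finally show ?case .
    qed
  qed
qed

lemma double_ray_path:
  assumes X: "X \<in> CG" and Y: "Y \<in> CG"
    and p: "\<And>k. {p k, p (Suc k)} \<in> E - W"
      "\<And>e. 0 < e \<Longrightarrow> \<forall>\<^sub>F k in sequentially. cd X (pt (p k)) < e"
    and q: "\<And>k. {q k, q (Suc k)} \<in> E - W"
      "\<And>e. 0 < e \<Longrightarrow> \<forall>\<^sub>F k in sequentially. cd Y (pt (q k)) < e"
    and "p 0 = q 0"
  obtains g where "is_gpath V E g" "gpath_from V E R g X" "gpath_to V E R g Y"
    "gpath_edges g \<inter> W = {}"
proof -
  \<comment> \<open>The first ray is run backwards on the negative integers and the second forwards;
    they share the vertex at index 0.\<close>
  define f where "f k = (if 0 \<le> k then q (nat k) else p (nat (- k)))" for k :: int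
  have edge: "{f k, f (k + 1)} \<in> E - W" for k
  proof (cases "0 \<le> k")
    case True
    then have "nat (k + 1) = Suc (nat k)" by simp
    then show ?thesis using q(1)[of "nat k"] True by (simp add: f_def)
  next
    case False
    then have k: "nat (- k) = Suc (nat (- (k + 1)))" by simp
    have "f (k + 1) = p (nat (- (k + 1)))"
      using False \<open>p 0 = q 0\<close> by (auto simp: f_def)
    then show ?thesis using p(1)[of "nat (- (k + 1))"] False
      by (simp add: f_def k insert_commute)
  qed
  have V: "f k \<in> V" for k using edge[of k] edge_vertices by blast
  have top: "\<forall>\<^sub>F k in at_top. cd Y (pt (f k)) < e" if e: "0 < e" for e
  proof -
    obtain N where "\<And>k. N \<le> k \<Longrightarrow> cd Y (pt (q k)) < e"
      using q(2)[OF e] by (auto simp: eventually_sequentially)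
    then show ?thesis
      unfolding eventually_at_top_linorder by (intro exI[of _ "int N"]) (auto simp: f_def)
  qed
  have bot: "\<forall>\<^sub>F k in at_bot. cd X (pt (f k)) < e" if e: "0 < e" for e
  proof -
    obtain N where "\<And>k. N \<le> k \<Longrightarrow> cd X (pt (p k)) < e"
      using p(2)[OF e] by (auto simp: eventually_sequentially)
    \<comment> \<open>The extra \<open>- 1\<close> keeps the index negative even for
      \<open>N = 0\<close>, so that \<open>f\<close> takes its values from \<open>p\<close>.\<close>
    then show ?thesis
      unfolding eventually_at_bot_linorder
      by (intro exI[of _ "- int N - 1"]) (auto simp: f_def)
  qed
  show ?thesis
  proof (rule that[of "Double_Ray f"])
    show "is_gpath V E (Double_Ray f)" using V edge by auto
    show "gpath_from V E R (Double_Ray f) X" "gpath_to V E R (Double_Ray f) Y"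
      unfolding gpath_from.simps gpath_to.simps completion_topology_def
      by (intro limitin_ext_topology X Y pt_in V bot top; assumption)+
    show "gpath_edges (Double_Ray f) \<inter> W = {}" using edge by auto
  qed
qed

section \<open>Total disconnectedness\<close>

text \<open>Since \<open>x\<close> is isolated, the splitting into \<open>{x}\<close> and
  \<open>V - {x}\<close> is clopen, and \<open>pt x\<close> is the only point on its side.\<close>

lemma vertex_component:
  assumes x: "x \<in> V" and S: "connectedin (graph_completion_topology V E R) S" "pt x \<in> S" "Y \<in> S"
  shows "Y = pt x"
proof -
  let ?O = "completion_exterior V gd"
  obtain c where c: "0 < c" "\<And>v. v \<noteq> x \<Longrightarrow> c \<le> gd x v" using vertex_isolated[OF x] by blast
  have X: "pt x \<in> ?O (V - {x})"
    using c pt_in[OF x] cd_pt[OF x] by (auto simp: completion_exterior_def)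
  have other: "Z \<in> ?O {x}" if "Z \<in> CG" "Z \<noteq> pt x" for Z
    using cd_zero[OF that(1) pt_in[OF x]] that
    by (auto simp: completion_exterior_def zero_less_iff_neq_zero intro: exI[of _ "cd Z (pt x)"])
  have "Y \<in> ?O (V - {x})"
    using connectedin_completion_split[OF gd _ _ S X] x X other by blast
  then show ?thesis
    using other[of Y] completion_exterior_disjoint[OF gd, of "{x}"]
    by (auto simp: completion_exterior_def)
qed

lemma totally_disconnected_completion:
  assumes weak: "weakly_connected V E R"
  shows "totally_disconnected_space (graph_completion_topology V E R)"
  unfolding totally_disconnected_space_def
proof (intro allI impI ballI)
  fix S X Y
  assume S: "connectedin (graph_completion_topology V E R) S" "X \<in> S" "Y \<in> S"
  have "S \<subseteq> CG"
    using connectedin_subset_topspace[OF S(1)] by (simp add: completion_topology_def)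
  then have X: "X \<in> CG" and Y: "Y \<in> CG" using S by auto
  show "X = Y"
  proof (cases "X \<in> pt ` V \<or> Y \<in> pt ` V")
    case True
    then show ?thesis using vertex_component[OF _ S(1)] S(2,3) by blast
  next
    case False
    show ?thesis
    proof (rule ccontr)
      assume "X \<noteq> Y"
      then obtain W where W: "finite W" "W \<subseteq> E"
        and sep: "\<And>g. is_gpath V E g \<Longrightarrow> gpath_from V E R g X \<Longrightarrow> gpath_to V E R g Y \<Longrightarrow>
          gpath_edges g \<inter> W \<noteq> {}"
        using weak X Y unfolding weakly_connected_def by meson
      let ?r = "(edges_without W)\<^sup>*" and ?O = "completion_exterior V gd"
      obtain \<delta> where \<delta>: "0 < \<delta>" "\<And>u v. u \<in> V \<Longrightarrow> v \<in> V \<Longrightarrow> cd X (pt u) < \<delta> \<Longrightarrow>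
          cd X (pt v) < \<delta> \<Longrightarrow> (u, v) \<in> ?r"
        using local_connectivity[OF X W] by blast
      obtain u where u: "u \<in> V" "cd X (pt u) < \<delta>"
        using completion_embed_dense[OF gd X \<delta>(1)] by blast
      define C where "C = {v \<in> V. (u, v) \<in> ?r}"
      have cover: "CG \<subseteq> ?O C \<union> ?O (V - C)"
      proof
        fix Z assume Z: "Z \<in> CG"
        obtain e where e: "0 < e" "\<And>u v. u \<in> V \<Longrightarrow> v \<in> V \<Longrightarrow> cd Z (pt u) < e \<Longrightarrow>
            cd Z (pt v) < e \<Longrightarrow> (u, v) \<in> ?r"
          using local_connectivity[OF Z W] by blast
        \<comment> \<open>Vertices within \<open>e\<close> of \<open>Z\<close> are mutually
          reachable without \<open>W\<close>, so they cannot lie partly inside and partly outside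
          the component \<open>C\<close>.\<close>
        have "(\<forall>v\<in>C. e \<le> cd Z (pt v)) \<or> (\<forall>v\<in>V - C. e \<le> cd Z (pt v))"
        proof (rule ccontr)
          assume "\<not> ?thesis"
          then obtain v w where "v \<in> C" "w \<in> V - C" "cd Z (pt v) < e" "cd Z (pt w) < e"
            by (auto simp: not_le)
          then show False using e(2)[of v w] by (auto simp: C_def intro: rtrancl_trans)
        qed
        then show "Z \<in> ?O C \<union> ?O (V - C)" using e(1) Z by (auto simp: completion_exterior_def)
      qed
      \<comment> \<open>Every vertex within \<delta> of \<open>X\<close> is reachable from
        \<open>u\<close>, so \<open>X\<close> is bounded away from the complement of
        \<open>C\<close>.\<close>
      have "\<delta> \<le> cd X (pt v)" if "v \<in> V - C" for v
        using that \<delta>(2)[OF u(1) _ u(2), of v] by (auto simp: C_def not_less[symmetric])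
      then have XO: "X \<in> ?O (V - C)" using X \<delta>(1) by (auto simp: completion_exterior_def)
      have "C \<subseteq> V" by (auto simp: C_def)
      then have "Y \<in> ?O (V - C)" by (rule connectedin_completion_split[OF gd _ cover S XO])
      then have "Y \<notin> ?O C" using completion_exterior_disjoint[OF gd, of C] by blast
      \<comment> \<open>Failing to lie in the exterior of \<open>C\<close> means having vertices of
        \<open>C\<close> arbitrarily close; this is the accumulation hypothesis for the ray to
        \<open>Y\<close>.\<close>
      then have accY: "\<exists>v\<in>V. (u, v) \<in> ?r \<and> cd Y (pt v) < e" if "0 < e" for e
        using that Y unfolding completion_exterior_def C_def by (force simp: not_le)
      have accX: "\<exists>v\<in>V. (u, v) \<in> ?r \<and> cd X (pt v) < e" if "0 < e" for e
      proof -
        have "0 < min e \<delta>" using that \<delta>(1) by simp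
        then obtain v where "v \<in> V" "cd X (pt v) < min e \<delta>"
          by (rule completion_embed_dense[OF gd X])
        then show ?thesis using \<delta>(2)[OF u(1) _ u(2), of v] by auto
      qed
      obtain p where p: "p 0 = u" "\<And>k. {p k, p (Suc k)} \<in> E - W"
        "\<And>e. 0 < e \<Longrightarrow> \<forall>\<^sub>F k in sequentially. cd X (pt (p k)) < e"
        using ray_to_boundary[OF X _ W u(1) accX] False by blast
      obtain q where q: "q 0 = u" "\<And>k. {q k, q (Suc k)} \<in> E - W"
        "\<And>e. 0 < e \<Longrightarrow> \<forall>\<^sub>F k in sequentially. cd Y (pt (q k)) < e"
        using ray_to_boundary[OF Y _ W u(1) accY] False by blast
      \<comment> \<open>Both rays start at \<open>u\<close> and avoid \<open>W\<close>, so joining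
        them contradicts the choice of \<open>W\<close>.\<close>
      obtain g where "is_gpath V E g" "gpath_from V E R g X" "gpath_to V E R g Y"
        "gpath_edges g \<inter> W = {}"
        using double_ray_path[OF X Y p(2,3) q(2,3)] p(1) q(1) by metis
      then show False using sep by blast
    qed
  qed
qed

end

theorem theorem2p6:
  fixes V :: "'v set" and E :: "'v set set" and R :: "'v \<Rightarrow> 'v \<Rightarrow> real"
  assumes "edge_weighted_graph V E R"
    and "weakly_connected V E R"
  shows "totally_disconnected_space (graph_completion_topology V E R)"
  using edge_weighted_graph.totally_disconnected_completion[OF assms] .

end
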